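(* Let $K$ be a $p$-pure simplicial complex with $q$ facets in which no three facets have triangle intersection. Then the intersection data of degrees $1$ and $2$ determines $K$ uniquely up to isomorphism among such complexes. That is: if $K$ and $K'$ are facet-labeled $p$-pure simplicial complexes with facets $F_1,\dots,F_q$ and $F'_1,\dots,F'_q$ respectively, neither of which has a set of three facets with triangle intersection, and if $|F_i\cap F_j|=|F'_i\cap F'_j|$ for all $i,j\in\{1,\dots,q\}$, then $K$ and $K'$ are isomorphic.
   Context: A finite abstract simplicial complex is a collection of subsets (faces) of a finite base set closed under taking subsets; facets are its inclusion-maximal faces, and the base set is the union of the facets. A complex is $p$-pure ($p$ a positive integer) if all of its facets have cardinality $p$. It is facet-labeled if its $q$ distinct facets are labeled by $1,\dots,q$. The intersection data of degree $k$ ($1\le k\le q$) of a facet-labeled complex is the labeled family of the numbers $|F_{i_1}\cap\cdots\cap F_{i_k}|$ over all choices of $k$ distinct facets. Three distinct facets $F_1,F_2,F_3$ have triangle intersection if the three sets $(F_2\cap F_3)\setminus F_1$, $(F_1\cap F_3)\setminus F_2$, $(F_1\cap F_2)\setminus F_3$ are all non-empty. Two simplicial complexes are isomorphic if there is a bijection of their vertex sets inducing a bijection between their faces. *)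

theory Defs
  imports Main
begin

text \<open>
  A complex is represented by its set of faces. A finite base set makes the union of all faces
  finite, and by \<open>Union_facets\<close> below that union is the union of the facets, so the base set
  (vertex set) of \<^term>\<open>K\<close> is written \<^term>\<open>\<Union>K\<close>. The empty set is a face of every
  nonempty complex.
\<close>

definition abstract_simplicial_complex :: "'a set set \<Rightarrow> bool" where
  "abstract_simplicial_complex K \<longleftrightarrow>
     finite (\<Union>K) \<and> (\<forall>s\<in>K. \<forall>t. t \<subseteq> s \<longrightarrow> t \<in> K)"

definition facets :: "'a set set \<Rightarrow> 'a set set" where
  "facets K = {s \<in> K. \<forall>t\<in>K. \<not> s \<subset> t}"

lemma Union_facets:
  assumes "abstract_simplicial_complex K"
  shows "\<Union>(facets K) = \<Union>K"
proof
  show "\<Union>(facets K) \<subseteq> \<Union>K"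
    by (auto simp: facets_def)
  have "finite K"
    using assms finite_UnionD unfolding abstract_simplicial_complex_def by blast
  have "\<exists>t\<in>facets K. s \<subseteq> t" if s: "s \<in> K" for s
  proof -
    obtain t where "t \<in> K" "s \<subseteq> t" "\<forall>u\<in>K. t \<subseteq> u \<longrightarrow> t = u"
      using finite_has_maximal2[OF \<open>finite K\<close> s] by metis
    then show ?thesis
      unfolding facets_def by blast
  qed
  then show "\<Union>K \<subseteq> \<Union>(facets K)"
    by blast
qed

definition pure_complex :: "nat \<Rightarrow> 'a set set \<Rightarrow> bool" where
  "pure_complex p K \<longleftrightarrow> p > 0 \<and> (\<forall>s\<in>facets K. card s = p)"

definition facet_labeling :: "nat \<Rightarrow> (nat \<Rightarrow> 'a set) \<Rightarrow> 'a set set \<Rightarrow> bool" where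
  "facet_labeling q F K \<longleftrightarrow> bij_betw F {1..q} (facets K)"

definition triangle_intersection :: "'a set \<Rightarrow> 'a set \<Rightarrow> 'a set \<Rightarrow> bool" where
  "triangle_intersection F1 F2 F3 \<longleftrightarrow>
     (F2 \<inter> F3) - F1 \<noteq> {} \<and> (F1 \<inter> F3) - F2 \<noteq> {} \<and> (F1 \<inter> F2) - F3 \<noteq> {}"

definition has_triangle_intersection :: "'a set set \<Rightarrow> bool" where
  "has_triangle_intersection K \<longleftrightarrow>
     (\<exists>F1\<in>facets K. \<exists>F2\<in>facets K. \<exists>F3\<in>facets K.
        F1 \<noteq> F2 \<and> F1 \<noteq> F3 \<and> F2 \<noteq> F3 \<and> triangle_intersection F1 F2 F3)"

definition isomorphic_complexes :: "'a set set \<Rightarrow> 'b set set \<Rightarrow> bool" where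
  "isomorphic_complexes K K' \<longleftrightarrow>
     (\<exists>f. bij_betw f (\<Union>K) (\<Union>K') \<and> bij_betw (\<lambda>s. f ` s) K K')"

end

theory Submission
  imports Defs
begin

text \<open>
  If three sets have no triangle intersection, one of the pairwise intersections lies inside the
  third set, so the triple intersection is already a pairwise one. Absorbing one set after another,
  the intersection of any nonempty subfamily of the facets is equal to the intersection of two of
  its members (possibly equal), and it is then the smallest of all such pairwise intersections.
  Hence the data of degrees \<open>1\<close> and \<open>2\<close> determine the data of every degree
  (\<open>card_INT_eq_if_card_Int_eq\<close>).

  The data of all degrees determine, by Moebius inversion, how many vertices lie in exactly the
  facets with labels in a given set \<open>S\<close> (\<open>card_incidence_fiber_eq\<close>). Matching up
  vertices that lie in facets with the same labels gives a bijection of the vertex sets that carries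
  each facet to the facet with the same label, and a complex is determined by its facets.
\<close>

text \<open>
  Repetitions among the three indices cause no exception: if two of them coincide, one of the
  inclusions is trivial. This is why the hypothesis can range over all triples.
\<close>

lemma INT_eq_Int_of_two:
  fixes F :: "'i \<Rightarrow> 'a set"
  assumes "finite I" and "I \<noteq> {}"
    and "\<And>i j k. i \<in> I \<Longrightarrow> j \<in> I \<Longrightarrow> k \<in> I \<Longrightarrow>
           F j \<inter> F k \<subseteq> F i \<or> F i \<inter> F k \<subseteq> F j \<or> F i \<inter> F j \<subseteq> F k"
  shows "\<exists>i\<in>I. \<exists>j\<in>I. (\<Inter>l\<in>I. F l) = F i \<inter> F j"
  using assms
proof (induction I rule: finite_ne_induct)
  case (singleton x)
  then show ?case by simp
next
  case (insert k I)
  have "\<exists>i\<in>I. \<exists>j\<in>I. (\<Inter>l\<in>I. F l) = F i \<inter> F j"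
    by (rule insert.IH) (use insert.prems in blast)
  then obtain i j where ij: "i \<in> I" "j \<in> I" and eq: "(\<Inter>l\<in>I. F l) = F i \<inter> F j"
    by blast
  have "(\<Inter>l\<in>insert k I. F l) = F k \<inter> (F i \<inter> F j)"
    using eq by simp
  moreover have "F j \<inter> F k \<subseteq> F i \<or> F i \<inter> F k \<subseteq> F j \<or> F i \<inter> F j \<subseteq> F k"
    using insert.prems ij by blast
  ultimately have "(\<Inter>l\<in>insert k I. F l) = F j \<inter> F k \<or>
      (\<Inter>l\<in>insert k I. F l) = F i \<inter> F k \<or> (\<Inter>l\<in>insert k I. F l) = F i \<inter> F j"
    by blast
  then show ?case
    using ij by blast
qed

text \<open>
  Write the intersection on the right as the intersection of two members. The two members of the
  other family with the same indices have an intersection of the same size, and it contains the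
  whole intersection on the left.
\<close>

lemma card_INT_le_if_card_Int_eq:
  fixes F :: "'i \<Rightarrow> 'a set" and F' :: "'i \<Rightarrow> 'b set"
  assumes "finite I" and "I \<noteq> {}"
    and "\<And>i. i \<in> I \<Longrightarrow> finite (F i)"
    and "\<And>i j k. i \<in> I \<Longrightarrow> j \<in> I \<Longrightarrow> k \<in> I \<Longrightarrow>
           F' j \<inter> F' k \<subseteq> F' i \<or> F' i \<inter> F' k \<subseteq> F' j \<or> F' i \<inter> F' j \<subseteq> F' k"
    and "\<And>i j. i \<in> I \<Longrightarrow> j \<in> I \<Longrightarrow> card (F i \<inter> F j) = card (F' i \<inter> F' j)"
  shows "card (\<Inter>l\<in>I. F l) \<le> card (\<Inter>l\<in>I. F' l)"
proof -
  have "\<exists>i\<in>I. \<exists>j\<in>I. (\<Inter>l\<in>I. F' l) = F' i \<inter> F' j"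
    by (rule INT_eq_Int_of_two[OF assms(1,2,4)])
  then obtain i j where ij: "i \<in> I" "j \<in> I" and eq: "(\<Inter>l\<in>I. F' l) = F' i \<inter> F' j"
    by blast
  have "card (\<Inter>l\<in>I. F l) \<le> card (F i \<inter> F j)"
    by (rule card_mono) (use ij assms(3) in auto)
  then show ?thesis
    using assms(5)[OF ij] eq by simp
qed

lemma card_INT_eq_if_card_Int_eq:
  fixes F :: "'i \<Rightarrow> 'a set" and F' :: "'i \<Rightarrow> 'b set"
  assumes "finite I" and "I \<noteq> {}"
    and "\<And>i. i \<in> I \<Longrightarrow> finite (F i)" and "\<And>i. i \<in> I \<Longrightarrow> finite (F' i)"
    and "\<And>i j k. i \<in> I \<Longrightarrow> j \<in> I \<Longrightarrow> k \<in> I \<Longrightarrow>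
           F j \<inter> F k \<subseteq> F i \<or> F i \<inter> F k \<subseteq> F j \<or> F i \<inter> F j \<subseteq> F k"
    and "\<And>i j k. i \<in> I \<Longrightarrow> j \<in> I \<Longrightarrow> k \<in> I \<Longrightarrow>
           F' j \<inter> F' k \<subseteq> F' i \<or> F' i \<inter> F' k \<subseteq> F' j \<or> F' i \<inter> F' j \<subseteq> F' k"
    and "\<And>i j. i \<in> I \<Longrightarrow> j \<in> I \<Longrightarrow> card (F i \<inter> F j) = card (F' i \<inter> F' j)"
  shows "card (\<Inter>l\<in>I. F l) = card (\<Inter>l\<in>I. F' l)"
  by (rule antisym; rule card_INT_le_if_card_Int_eq) (use assms in auto)

definition incidence :: "'i set \<Rightarrow> ('i \<Rightarrow> 'a set) \<Rightarrow> 'a \<Rightarrow> 'i set" where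
  "incidence I F v = {i \<in> I. v \<in> F i}"

text \<open>
  The points of an intersection, sorted by their incidence sets. Solving for the summand
  \<open>T = S\<close> expresses it through the intersection over \<open>S\<close> and the fibres of strictly
  larger incidence sets; this recursion is the Moebius inversion.
\<close>

lemma card_INT_eq_sum_incidence_fibers:
  assumes "finite I" and "\<And>i. i \<in> I \<Longrightarrow> finite (F i)" and "S \<subseteq> I" and "S \<noteq> {}"
  shows "card (\<Inter>i\<in>S. F i) =
    (\<Sum>T | S \<subseteq> T \<and> T \<subseteq> I. card {v \<in> \<Union>(F ` I). incidence I F v = T})"
proof -
  have "(\<Inter>i\<in>S. F i) =
      (\<Union>T\<in>{T. S \<subseteq> T \<and> T \<subseteq> I}. {v \<in> \<Union>(F ` I). incidence I F v = T})"
    using assms(3,4) by (fastforce simp: incidence_def)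
  also have "card \<dots> =
      (\<Sum>T | S \<subseteq> T \<and> T \<subseteq> I. card {v \<in> \<Union>(F ` I). incidence I F v = T})"
    by (rule card_UN_disjoint) (use assms(1,2) in auto)
  finally show ?thesis .
qed

lemma card_incidence_fiber_eq:
  fixes F :: "'i \<Rightarrow> 'a set" and F' :: "'i \<Rightarrow> 'b set"
  assumes fin: "finite I"
    and finF: "\<And>i. i \<in> I \<Longrightarrow> finite (F i)" and finF': "\<And>i. i \<in> I \<Longrightarrow> finite (F' i)"
    and card_eq: "\<And>S. S \<subseteq> I \<Longrightarrow> S \<noteq> {} \<Longrightarrow> card (\<Inter>i\<in>S. F i) = card (\<Inter>i\<in>S. F' i)"
  shows "card {v \<in> \<Union>(F ` I). incidence I F v = S} =
    card {v \<in> \<Union>(F' ` I). incidence I F' v = S}"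
proof (cases "S \<subseteq> I \<and> S \<noteq> {}")
  case False
  \<comment> \<open>No point of the union has such an incidence set, so both fibres are empty.\<close>
  then have "{v \<in> \<Union>(F ` I). incidence I F v = S} = {}"
    and "{v \<in> \<Union>(F' ` I). incidence I F' v = S} = {}"
    by (auto simp: incidence_def)
  then show ?thesis by (simp only: card.empty)
next
  case True
  then show ?thesis
  proof (induction "card (I - S)" arbitrary: S rule: less_induct)
    case less
    let ?a = "\<lambda>T. card {v \<in> \<Union>(F ` I). incidence I F v = T}"
    let ?a' = "\<lambda>T. card {v \<in> \<Union>(F' ` I). incidence I F' v = T}"
    let ?U = "{T. S \<subset> T \<and> T \<subseteq> I}"
    have U: "{T. S \<subseteq> T \<and> T \<subseteq> I} = insert S ?U" and finU: "finite ?U"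
      using less.prems fin by auto
    have "?a T = ?a' T" if "T \<in> ?U" for T
    proof (rule less.hyps)
      show "card (I - T) < card (I - S)"
        by (rule psubset_card_mono) (use that fin in auto)
      show "T \<subseteq> I \<and> T \<noteq> {}" using that by auto
    qed
    then have "sum ?a ?U = sum ?a' ?U"
      by (intro sum.cong refl)
    moreover have "?a S + sum ?a ?U = ?a' S + sum ?a' ?U"
      using card_INT_eq_sum_incidence_fibers[OF fin finF, where S=S]
        card_INT_eq_sum_incidence_fibers[OF fin finF', where S=S]
        card_eq[of S] less.prems finU unfolding U by simp
    ultimately show ?case by simp
  qed
qed

lemma fiber_preserving_bij_betw:
  fixes t :: "'a \<Rightarrow> 'c" and t' :: "'b \<Rightarrow> 'c"
  assumes "finite A" and "finite B"
    and "\<And>c. card {a \<in> A. t a = c} = card {b \<in> B. t' b = c}"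
  shows "\<exists>f. bij_betw f A B \<and> (\<forall>a\<in>A. t' (f a) = t a)"
proof -
  have "\<forall>c. \<exists>g. bij_betw g {a \<in> A. t a = c} {b \<in> B. t' b = c}"
    using assms by (intro allI finite_same_card_bij) auto
  then obtain g where g: "\<And>c. bij_betw (g c) {a \<in> A. t a = c} {b \<in> B. t' b = c}"
    by metis
  define f where "f a = g (t a) a" for a
  have f: "f a \<in> B \<and> t' (f a) = t a" if "a \<in> A" for a
    using bij_betwE[OF g[of "t a"]] that by (auto simp: f_def)
  have "inj_on f A"
  proof (rule inj_onI)
    fix x y assume xy: "x \<in> A" "y \<in> A" "f x = f y"
    then have "t x = t y" using f by metis
    with xy show "x = y"
      using bij_betw_imp_inj_on[OF g[of "t x"]] by (auto simp: f_def inj_on_def)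
  qed
  moreover have "b \<in> f ` A" if "b \<in> B" for b
  proof -
    have "b \<in> g (t' b) ` {a \<in> A. t a = t' b}"
      using that bij_betw_imp_surj_on[OF g[of "t' b"]] by simp
    then obtain a where "a \<in> A" "t a = t' b" "b = g (t' b) a" by auto
    then show ?thesis by (intro image_eqI[of _ _ a]) (simp_all add: f_def)
  qed
  ultimately show ?thesis
    using f by (auto simp: bij_betw_def)
qed

lemma complex_eq_UN_Pow_facets:
  assumes "abstract_simplicial_complex K"
  shows "K = (\<Union>s\<in>facets K. Pow s)"
proof -
  have "finite K"
    using assms finite_UnionD unfolding abstract_simplicial_complex_def by blast
  have "\<exists>t\<in>facets K. s \<subseteq> t" if s: "s \<in> K" for s
  proof -
    obtain t where "t \<in> K" "s \<subseteq> t" "\<forall>u\<in>K. t \<subseteq> u \<longrightarrow> t = u"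
      using finite_has_maximal2[OF \<open>finite K\<close> s] by metis
    then show ?thesis
      unfolding facets_def by blast
  qed
  then show ?thesis
    using assms by (auto simp: facets_def abstract_simplicial_complex_def)
qed

lemma isomorphic_complexes_if_facets_correspond:
  assumes K: "abstract_simplicial_complex K" and K': "abstract_simplicial_complex K'"
    and F: "facets K = F ` I" and F': "facets K' = F' ` I"
    and f: "bij_betw f (\<Union>K) (\<Union>K')" and fF: "\<And>i. i \<in> I \<Longrightarrow> f ` F i = F' i"
  shows "isomorphic_complexes K K'"
proof -
  have "inj_on ((`) f) K"
    using inj_on_image_Pow[OF bij_betw_imp_inj_on[OF f]] by (rule inj_on_subset) auto
  moreover have "(`) f ` K = K'"
  proof -
    have "(`) f ` K = (\<Union>i\<in>I. (`) f ` Pow (F i))"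
      using complex_eq_UN_Pow_facets[OF K] F by (metis UN_extend_simps(10) image_UN)
    also have "\<dots> = (\<Union>i\<in>I. Pow (F' i))"
      by (intro SUP_cong refl) (metis fF image_Pow_surj)
    also have "\<dots> = K'"
      using complex_eq_UN_Pow_facets[OF K'] F' by simp
    finally show ?thesis .
  qed
  ultimately show ?thesis
    using f unfolding isomorphic_complexes_def bij_betw_def by blast
qed

lemma labeled_facets_no_triangle:
  assumes "facet_labeling q F K" and "\<not> has_triangle_intersection K"
    and "i \<in> {1..q}" and "j \<in> {1..q}" and "k \<in> {1..q}"
  shows "F j \<inter> F k \<subseteq> F i \<or> F i \<inter> F k \<subseteq> F j \<or> F i \<inter> F j \<subseteq> F k"
proof (cases "F i = F j \<or> F i = F k \<or> F j = F k")
  case True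
  then show ?thesis by blast
next
  case False
  have "F i \<in> facets K" "F j \<in> facets K" "F k \<in> facets K"
    using assms(1,3-5) by (auto simp: facet_labeling_def bij_betw_def)
  then have "\<not> triangle_intersection (F i) (F j) (F k)"
    using False assms(2) unfolding has_triangle_intersection_def by blast
  then show ?thesis
    unfolding triangle_intersection_def by blast
qed

theorem theorem3p3:
  fixes K :: "'a set set" and K' :: "'b set set"
    and F :: "nat \<Rightarrow> 'a set" and F' :: "nat \<Rightarrow> 'b set"
    and p q :: nat
  assumes "abstract_simplicial_complex K" and "abstract_simplicial_complex K'"
    and "pure_complex p K" and "pure_complex p K'"
    and "facet_labeling q F K" and "facet_labeling q F' K'"
    and "\<not> has_triangle_intersection K" and "\<not> has_triangle_intersection K'"
    and "\<forall>i\<in>{1..q}. \<forall>j\<in>{1..q}. card (F i \<inter> F j) = card (F' i \<inter> F' j)"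
  shows "isomorphic_complexes K K'"
proof -
  let ?I = "{1..q}"
  have F: "facets K = F ` ?I" and F': "facets K' = F' ` ?I"
    using assms(5,6) by (auto simp: facet_labeling_def bij_betw_def)
  have X: "\<Union>K = \<Union>(F ` ?I)" and X': "\<Union>K' = \<Union>(F' ` ?I)"
    using Union_facets assms(1,2) F F' by metis+
  have finX: "finite (\<Union>(F ` ?I))" and finX': "finite (\<Union>(F' ` ?I))"
    using assms(1,2) X X' by (auto simp: abstract_simplicial_complex_def)
  have finF: "finite (F i)" and finF': "finite (F' i)" if "i \<in> ?I" for i
    using that finX finX' by auto
  have "card (\<Inter>i\<in>S. F i) = card (\<Inter>i\<in>S. F' i)" if S: "S \<subseteq> ?I" "S \<noteq> {}" for S
  proof (rule card_INT_eq_if_card_Int_eq)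
    show "finite S" using S(1) finite_subset by blast
    show "F j \<inter> F k \<subseteq> F i \<or> F i \<inter> F k \<subseteq> F j \<or> F i \<inter> F j \<subseteq> F k"
      if "i \<in> S" "j \<in> S" "k \<in> S" for i j k
      by (rule labeled_facets_no_triangle[OF assms(5,7)]) (use that S in blast)+
    show "F' j \<inter> F' k \<subseteq> F' i \<or> F' i \<inter> F' k \<subseteq> F' j \<or> F' i \<inter> F' j \<subseteq> F' k"
      if "i \<in> S" "j \<in> S" "k \<in> S" for i j k
      by (rule labeled_facets_no_triangle[OF assms(6,8)]) (use that S in blast)+
    show "card (F i \<inter> F j) = card (F' i \<inter> F' j)" if "i \<in> S" "j \<in> S" for i j
      using that S assms(9) by blast
  qed (use S finF finF' in blast)+
  then have "card {v \<in> \<Union>(F ` ?I). incidence ?I F v = S} =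
      card {v \<in> \<Union>(F' ` ?I). incidence ?I F' v = S}" for S
    by (intro card_incidence_fiber_eq finF finF' finite_atLeastAtMost)
  then obtain f where f: "bij_betw f (\<Union>(F ` ?I)) (\<Union>(F' ` ?I))"
    and inc: "\<forall>v\<in>\<Union>(F ` ?I). incidence ?I F' (f v) = incidence ?I F v"
    using fiber_preserving_bij_betw[OF finX finX'] by blast
  have "f ` F i = F' i" if i: "i \<in> ?I" for i
  proof -
    have iff: "f v \<in> F' i \<longleftrightarrow> v \<in> F i" if "v \<in> \<Union>(F ` ?I)" for v
      using inc that i unfolding incidence_def by blast
    have surj: "f ` \<Union>(F ` ?I) = \<Union>(F' ` ?I)"
      using f by (rule bij_betw_imp_surj_on)
    show ?thesis
    proof
      show "f ` F i \<subseteq> F' i" using iff i by blast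
      show "F' i \<subseteq> f ` F i"
      proof
        fix w assume w: "w \<in> F' i"
        then have "w \<in> f ` \<Union>(F ` ?I)" using surj i by blast
        then show "w \<in> f ` F i" using iff w by blast
      qed
    qed
  qed
  then show ?thesis
    using isomorphic_complexes_if_facets_correspond[OF assms(1,2) F F'] f X X' by simp
qed

end
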